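(* Let $H\subseteq E(\mathscr{X})$ be nonempty, let $\mathcal{X}\subseteq\mathscr{X}$ be $H$-closed for addition, and let $\pi^+_H\colon\mathcal{X}\to\mathscr{X}$ be the hyperedge addition partial transformation, i.e. $\pi^+_H(X)=X\boxplus H$ if $\bigcup H\subseteq V(X)$ and $H\cap E(X)=\emptyset$, and $\pi^+_H(X)=X$ otherwise. Define $$\mathcal{S}^+:=\{\,S\in\mathcal{X}\mid \textstyle\bigcup H\subseteq V(S),\ H\cap E(S)=\emptyset,\text{ and }S=S\wedge H\,\},$$ and for $X\in\mathcal{X}$ define $\mathcal{D}^+_X:=\{X\wedge H\}$ if $\bigcup H\subseteq V(X)$ and $H\cap E(X)=\emptyset$, and $\mathcal{D}^+_X:=\emptyset$ otherwise. Then: (1) $\mathcal{T}^+_H:=(\mathcal{X},\pi^+_H,\mathcal{S}^+)$ is a hypergraph transformation on $\mathscr{X}$ with $\mathcal{S}^+$-maximal subsets $\{\mathcal{D}^+_X\}_{X\in\mathcal{X}}$. (2) If $\mathcal{X}$ is $H$-closed then $\mathcal{T}^+_H$ is the support reduction, corresponding to $\mathcal{S}^+$, of the hyperedge addition/deletion transformation $\mathcal{T}_H:=(\mathcal{X},\pi_H,\mathcal{S})$, and $\mathcal{S}^+=\{S\in\mathcal{S}\mid H\cap E(S)=\emptyset\}$ and $\mathcal{D}^+_X=\mathcal{D}_X\cap\mathcal{S}^+$ for all $X\in\mathcal{X}$. Here $\pi_H(X)=X\boxplus H$ if $\bigcup H\subseteq V(X)$ and $\pi_H(X)=X$ otherwise;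 $\mathcal{S}=\{S\in\mathcal{X}\mid\bigcup H\subseteq V(S)\text{ and }S=S\wedge H\}$; and $\mathcal{D}_X=\{X\wedge H\}$ if $\bigcup H\subseteq V(X)$, $\mathcal{D}_X=\emptyset$ otherwise.
   Context: Hypergraphs. Fix a nonempty set $L_V$ of vertices (vertices are identified with their labels) and a set $\mathbb{E}$ of labelled hyperedges: each $e\in\mathbb{E}$ has an underlying nonempty finite subset of $L_V$, also written $e$; every nonempty finite subset of $L_V$ (of size $\ge 2$ if loops are disallowed) underlies at least one and only finitely many elements of $\mathbb{E}$, so multiple hyperedges are allowed. Loops ($|e|=1$) are either allowed throughout or disallowed throughout. A hypergraph is a pair $X=(V(X),E(X))$ with $V(X)\subseteq L_V$ finite, $E(X)\subseteq\mathbb{E}$ finite, and $e\subseteq V(X)$ for all $e\in E(X)$. Let $\mathscr{X}$ be the set of all hypergraphs (the hypergraph family), $V(\mathscr{X})=L_V$, $E(\mathscr{X})=\mathbb{E}$, and let $\mathcal{N}$ be the null hypergraph (no vertices). A hypergraph is connected if it is nonnull and any two vertices are joined by a path; $\mathcal{C}(X)$ denotes the set of connected components of $X$ (maximal connected subhypergraphs), so $\mathcal{C}(\mathcal{N})=\emptyset$. $X,Y$ are (vertex) disjoint if $V(X)\cap V(Y)=\emptyset$, and component disjoint if $\mathcal{C}(X)\cap\mathcal{C}(Y)=\emptyset$. For pairwise disjoint hypergraphs, the direct sum $\bigoplus_i X_i$ has vertex set $\bigcup_i V(X_i)$ and hyperedge set $\bigcup_i E(X_i)$; the empty direct sum is $\mathcal{N}$.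 If $X=Y\oplus Z$ with $Y,Z$ disjoint, the direct difference is $X\ominus Z:=Y$ (it is defined exactly when $\mathcal{C}(Z)\subseteq\mathcal{C}(X)$). Component maximality. For $\mathcal{S}\subseteq\mathcal{X}\subseteq\mathscr{X}$, $\mathcal{S}$ is component maximal in $\mathcal{X}$ if for each $X\in\mathcal{X}$ there is a subset $\mathcal{D}_X\subseteq\mathcal{S}$, called an $\mathcal{S}$-maximal subset, such that: (1) $\mathcal{D}_X$ is pairwise component disjoint; (2) if $\mathcal{N}\in\mathcal{S}$ then $\mathcal{N}\in\mathcal{D}_X$; (3) $\mathcal{C}(T)\subseteq\mathcal{C}(X)$ for all $T\in\mathcal{D}_X$; (4) if $S\in\mathcal{S}$ and $\mathcal{C}(S)\subseteq\mathcal{C}(X)$ then there is $T\in\mathcal{D}_X$ with $\mathcal{C}(S)\subseteq\mathcal{C}(T)$. (Such $\mathcal{D}_X$ is unique.) Hypergraph transformation. A partial transformation on $\mathscr{X}$ is a map $\pi\colon\mathcal{X}\to\mathscr{X}$ with $\mathcal{X}\subseteq\mathscr{X}$. A hypergraph transformation on $\mathscr{X}$ is a triple $(\mathcal{X},\pi,\mathcal{S})$ with $\pi\colon\mathcal{X}\to\mathscr{X}$ a partial transformation and $\mathcal{S}\subseteq\mathcal{X}$ (the distinguished hypergraphs) such that: (1) $\mathcal{C}(S)\cap\mathcal{C}(\pi(S))=\emptyset$ for all $S\in\mathcal{S}$, and if $\mathcal{N}\in\mathcal{S}$ then $\pi(\mathcal{N})\ne\mathcal{N}$ (nonredundancy);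 (2) $\mathcal{S}$ is component maximal in $\mathcal{X}$, with $\mathcal{S}$-maximal subsets $\{\mathcal{D}_X\}_{X\in\mathcal{X}}$; (3) for each $X\in\mathcal{X}$, with $\mathcal{S}_X:=\{S\in\mathcal{D}_X\mid V(\pi(S))\cap V(X\ominus S)=\emptyset\}$, the set $\pi(\mathcal{S}_X)$ consists of pairwise vertex-disjoint hypergraphs, $|\pi(\mathcal{S}_X)|=|\mathcal{S}_X|$, and $\pi(X)=\overline{X}\oplus\bigoplus_{S\in\mathcal{S}_X}\pi(S)$ where $\overline{X}:=X\ominus\bigoplus_{S\in\mathcal{S}_X}S$. Support reduction. A subset $\mathcal{S}'\subseteq\mathcal{S}$ is upward closed with respect to $\mathcal{S}$ if $S\in\mathcal{S}'$, $T\in\mathcal{S}$ and $\mathcal{C}(S)\subseteq\mathcal{C}(T)$ imply $T\in\mathcal{S}'$. A hypergraph transformation $(\mathcal{X},\pi',\mathcal{S}')$ is a support reduction of the hypergraph transformation $(\mathcal{X},\pi,\mathcal{S})$ corresponding to $\mathcal{S}'$ if $\mathcal{S}'\subseteq\mathcal{S}$, $\mathcal{S}'$ is upward closed with respect to $\mathcal{S}$, and $\pi'|_{\mathcal{S}'}=\pi|_{\mathcal{S}'}$. Hyperedge notation. For nonempty $H\subseteq E(\mathscr{X})$ and $X$ with $\bigcup H\subseteq V(X)$, $X\boxplus H$ is the hypergraph with vertex set $V(X)$ and hyperedge set the symmetric difference of $E(X)$ and $H$. For $H\subseteq E(\mathscr{X})$, $X\wedge H$ is the union of all $C\in\mathcal{C}(X)$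 such that $e\cap V(C)\neq\emptyset$ for some $e\in H$. $\mathcal{X}$ is $H$-closed if $X\in\mathcal{X}$ and $\bigcup H\subseteq V(X)$ imply $X\wedge H\in\mathcal{X}$; it is $H$-closed for addition if $X\in\mathcal{X}$, $\bigcup H\subseteq V(X)$ and $H\cap E(X)=\emptyset$ imply $X\wedge H\in\mathcal{X}$. *)

theory Defs
  imports Main "HOL-Library.FuncSet"
begin

(* A labelled hyperedge is an element of an arbitrary type 'e; the map "ends" sends it to its
   underlying vertex set, so multiple hyperedges with the same vertices are possible. *)

type_synonym ('v, 'e) hypergraph = "'v set \<times> 'e set"

abbreviation V :: "('v, 'e) hypergraph \<Rightarrow> 'v set" where "V \<equiv> fst"
abbreviation E :: "('v, 'e) hypergraph \<Rightarrow> 'e set" where "E \<equiv> snd"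

locale hypergraph_family =
  fixes LV :: "'v set" and EE :: "'e set" and ends :: "'e \<Rightarrow> 'v set" and loops :: bool
  assumes LV_nonempty: "LV \<noteq> {}"
    and ends_wf: "e \<in> EE \<Longrightarrow> ends e \<noteq> {} \<and> finite (ends e) \<and> ends e \<subseteq> LV"
    and no_loops: "\<not> loops \<Longrightarrow> e \<in> EE \<Longrightarrow> card (ends e) \<noteq> 1"
    and ends_ex: "A \<noteq> {} \<Longrightarrow> finite A \<Longrightarrow> A \<subseteq> LV \<Longrightarrow> loops \<or> card A \<ge> 2 \<Longrightarrow> \<exists>e\<in>EE. ends e = A"
    and ends_finite: "A \<noteq> {} \<Longrightarrow> finite A \<Longrightarrow> A \<subseteq> LV \<Longrightarrow> finite {e \<in> EE. ends e = A}"

definition edges_within :: "('e \<Rightarrow> 'v set) \<Rightarrow> ('v, 'e) hypergraph \<Rightarrow> bool" where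
  "edges_within ends X \<longleftrightarrow> (\<forall>e\<in>E X. ends e \<subseteq> V X)"

definition hypergraphs :: "'v set \<Rightarrow> 'e set \<Rightarrow> ('e \<Rightarrow> 'v set) \<Rightarrow> ('v, 'e) hypergraph set" where
  "hypergraphs LV EE ends =
     {X. finite (V X) \<and> V X \<subseteq> LV \<and> finite (E X) \<and> E X \<subseteq> EE \<and> edges_within ends X}"

definition null_hg :: "('v, 'e) hypergraph" where
  "null_hg = ({}, {})"

definition subhypergraph :: "('e \<Rightarrow> 'v set) \<Rightarrow> ('v, 'e) hypergraph \<Rightarrow> ('v, 'e) hypergraph \<Rightarrow> bool" where
  "subhypergraph ends Y X \<longleftrightarrow> edges_within ends Y \<and> V Y \<subseteq> V X \<and> E Y \<subseteq> E X"

(* The path vs!0, es!0, vs!1, es!1, ..., vs!n, with no repeated vertex or hyperedge. *)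
definition is_path :: "('e \<Rightarrow> 'v set) \<Rightarrow> ('v, 'e) hypergraph \<Rightarrow> 'v list \<Rightarrow> 'e list \<Rightarrow> bool" where
  "is_path ends X vs es \<longleftrightarrow>
     length vs = Suc (length es) \<and> set vs \<subseteq> V X \<and> set es \<subseteq> E X \<and> distinct vs \<and> distinct es \<and>
     (\<forall>i<length es. vs ! i \<in> ends (es ! i) \<and> vs ! Suc i \<in> ends (es ! i))"

definition connected_hg :: "('e \<Rightarrow> 'v set) \<Rightarrow> ('v, 'e) hypergraph \<Rightarrow> bool" where
  "connected_hg ends X \<longleftrightarrow> X \<noteq> null_hg \<and>
     (\<forall>u\<in>V X. \<forall>v\<in>V X. \<exists>vs es. is_path ends X vs es \<and> hd vs = u \<and> last vs = v)"

definition components :: "('e \<Rightarrow> 'v set) \<Rightarrow> ('v, 'e) hypergraph \<Rightarrow> ('v, 'e) hypergraph set" where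
  "components ends X =
     {C. subhypergraph ends C X \<and> connected_hg ends C \<and>
         (\<forall>D. subhypergraph ends D X \<and> connected_hg ends D \<and> subhypergraph ends C D \<longrightarrow> D = C)}"

definition vertex_disjoint :: "('v, 'e) hypergraph \<Rightarrow> ('v, 'e) hypergraph \<Rightarrow> bool" where
  "vertex_disjoint X Y \<longleftrightarrow> V X \<inter> V Y = {}"

definition component_disjoint ::
    "('e \<Rightarrow> 'v set) \<Rightarrow> ('v, 'e) hypergraph \<Rightarrow> ('v, 'e) hypergraph \<Rightarrow> bool" where
  "component_disjoint ends X Y \<longleftrightarrow> components ends X \<inter> components ends Y = {}"

definition hg_union :: "'i set \<Rightarrow> ('i \<Rightarrow> ('v, 'e) hypergraph) \<Rightarrow> ('v, 'e) hypergraph" where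
  "hg_union I f = (\<Union>i\<in>I. V (f i), \<Union>i\<in>I. E (f i))"

(* Direct sums are total functions here; they are only meaningful for pairwise vertex-disjoint
   summands. *)
abbreviation direct_sum :: "'i set \<Rightarrow> ('i \<Rightarrow> ('v, 'e) hypergraph) \<Rightarrow> ('v, 'e) hypergraph" where
  "direct_sum \<equiv> hg_union"

definition oplus :: "('v, 'e) hypergraph \<Rightarrow> ('v, 'e) hypergraph \<Rightarrow> ('v, 'e) hypergraph" where
  "oplus Y Z = (V Y \<union> V Z, E Y \<union> E Z)"

(* Unspecified when Z is not a direct summand of X. *)
definition direct_diff ::
    "('e \<Rightarrow> 'v set) \<Rightarrow> ('v, 'e) hypergraph \<Rightarrow> ('v, 'e) hypergraph \<Rightarrow> ('v, 'e) hypergraph" where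
  "direct_diff ends X Z = (THE Y. edges_within ends Y \<and> vertex_disjoint Y Z \<and> X = oplus Y Z)"

definition maximal_subset ::
    "('e \<Rightarrow> 'v set) \<Rightarrow> ('v, 'e) hypergraph set \<Rightarrow> ('v, 'e) hypergraph \<Rightarrow> ('v, 'e) hypergraph set \<Rightarrow> bool"
  where
  "maximal_subset ends \<S> X D \<longleftrightarrow>
     D \<subseteq> \<S> \<and>
     pairwise (component_disjoint ends) D \<and>
     (null_hg \<in> \<S> \<longrightarrow> null_hg \<in> D) \<and>
     (\<forall>T\<in>D. components ends T \<subseteq> components ends X) \<and>
     (\<forall>S\<in>\<S>. components ends S \<subseteq> components ends X \<longrightarrow>
        (\<exists>T\<in>D. components ends S \<subseteq> components ends T))"

(* \<S> is component maximal in \<X>, with \<S>-maximal subsets \<D> X for X in \<X>. *)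
definition component_maximal_with ::
    "('e \<Rightarrow> 'v set) \<Rightarrow> ('v, 'e) hypergraph set \<Rightarrow> ('v, 'e) hypergraph set \<Rightarrow>
     (('v, 'e) hypergraph \<Rightarrow> ('v, 'e) hypergraph set) \<Rightarrow> bool" where
  "component_maximal_with ends \<S> \<X> \<D> \<longleftrightarrow> \<S> \<subseteq> \<X> \<and> (\<forall>X\<in>\<X>. maximal_subset ends \<S> X (\<D> X))"

(* The set \<S>_X, computed from the maximal subset D of X. *)
definition applicable ::
    "('e \<Rightarrow> 'v set) \<Rightarrow> (('v, 'e) hypergraph \<Rightarrow> ('v, 'e) hypergraph) \<Rightarrow> ('v, 'e) hypergraph set \<Rightarrow>
     ('v, 'e) hypergraph \<Rightarrow> ('v, 'e) hypergraph set" where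
  "applicable ends \<pi> D X = {S \<in> D. V (\<pi> S) \<inter> V (direct_diff ends X S) = {}}"

(* A map \<pi> : \<X> \<rightarrow> hypergraphs is a total HOL function of which only the values on \<X> are used.
   In the formula for \<pi> X all direct differences are defined and all direct sums have disjoint
   summands, by component maximality, the definition of \<S>_X and the pairwise condition. *)
definition hypergraph_transformation_with ::
    "'v set \<Rightarrow> 'e set \<Rightarrow> ('e \<Rightarrow> 'v set) \<Rightarrow> ('v, 'e) hypergraph set \<Rightarrow>
     (('v, 'e) hypergraph \<Rightarrow> ('v, 'e) hypergraph) \<Rightarrow> ('v, 'e) hypergraph set \<Rightarrow>
     (('v, 'e) hypergraph \<Rightarrow> ('v, 'e) hypergraph set) \<Rightarrow> bool" where
  "hypergraph_transformation_with LV EE ends \<X> \<pi> \<S> \<D> \<longleftrightarrow>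
     \<X> \<subseteq> hypergraphs LV EE ends \<and>
     \<pi> \<in> \<X> \<rightarrow> hypergraphs LV EE ends \<and>
     \<S> \<subseteq> \<X> \<and>
     (\<forall>S\<in>\<S>. components ends S \<inter> components ends (\<pi> S) = {}) \<and>
     (null_hg \<in> \<S> \<longrightarrow> \<pi> null_hg \<noteq> null_hg) \<and>
     component_maximal_with ends \<S> \<X> \<D> \<and>
     (\<forall>X\<in>\<X>. let SX = applicable ends \<pi> (\<D> X) X in
        pairwise vertex_disjoint (\<pi> ` SX) \<and>
        card (\<pi> ` SX) = card SX \<and>
        \<pi> X = oplus (direct_diff ends X (direct_sum SX (\<lambda>S. S))) (direct_sum SX \<pi>))"

definition hypergraph_transformation ::
    "'v set \<Rightarrow> 'e set \<Rightarrow> ('e \<Rightarrow> 'v set) \<Rightarrow> ('v, 'e) hypergraph set \<Rightarrow>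
     (('v, 'e) hypergraph \<Rightarrow> ('v, 'e) hypergraph) \<Rightarrow> ('v, 'e) hypergraph set \<Rightarrow> bool" where
  "hypergraph_transformation LV EE ends \<X> \<pi> \<S> \<longleftrightarrow>
     (\<exists>\<D>. hypergraph_transformation_with LV EE ends \<X> \<pi> \<S> \<D>)"

definition upward_closed ::
    "('e \<Rightarrow> 'v set) \<Rightarrow> ('v, 'e) hypergraph set \<Rightarrow> ('v, 'e) hypergraph set \<Rightarrow> bool" where
  "upward_closed ends \<S>' \<S> \<longleftrightarrow>
     \<S>' \<subseteq> \<S> \<and>
     (\<forall>S\<in>\<S>'. \<forall>T\<in>\<S>. components ends S \<subseteq> components ends T \<longrightarrow> T \<in> \<S>')"

(* (\<X>, \<pi>', \<S>') is a support reduction of (\<X>, \<pi>, \<S>) corresponding to \<S>'. *)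
definition support_reduction ::
    "'v set \<Rightarrow> 'e set \<Rightarrow> ('e \<Rightarrow> 'v set) \<Rightarrow> ('v, 'e) hypergraph set \<Rightarrow>
     (('v, 'e) hypergraph \<Rightarrow> ('v, 'e) hypergraph) \<Rightarrow> ('v, 'e) hypergraph set \<Rightarrow>
     (('v, 'e) hypergraph \<Rightarrow> ('v, 'e) hypergraph) \<Rightarrow> ('v, 'e) hypergraph set \<Rightarrow> bool" where
  "support_reduction LV EE ends \<X> \<pi>' \<S>' \<pi> \<S> \<longleftrightarrow>
     hypergraph_transformation LV EE ends \<X> \<pi>' \<S>' \<and>
     hypergraph_transformation LV EE ends \<X> \<pi> \<S> \<and>
     \<S>' \<subseteq> \<S> \<and> upward_closed ends \<S>' \<S> \<and> (\<forall>S\<in>\<S>'. \<pi>' S = \<pi> S)"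

definition toggle :: "('v, 'e) hypergraph \<Rightarrow> 'e set \<Rightarrow> ('v, 'e) hypergraph" (infixl "\<boxplus>" 65) where
  "X \<boxplus> H = (V X, sym_diff (E X) H)"

(* The hypergraph written X \<and> H. *)
definition meet_edges :: "('e \<Rightarrow> 'v set) \<Rightarrow> ('v, 'e) hypergraph \<Rightarrow> 'e set \<Rightarrow> ('v, 'e) hypergraph" where
  "meet_edges ends X H =
     hg_union {C \<in> components ends X. \<exists>e\<in>H. ends e \<inter> V C \<noteq> {}} (\<lambda>C. C)"

definition covers :: "('e \<Rightarrow> 'v set) \<Rightarrow> ('v, 'e) hypergraph \<Rightarrow> 'e set \<Rightarrow> bool" where
  "covers ends X H \<longleftrightarrow> (\<Union>e\<in>H. ends e) \<subseteq> V X"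

definition H_closed :: "('e \<Rightarrow> 'v set) \<Rightarrow> 'e set \<Rightarrow> ('v, 'e) hypergraph set \<Rightarrow> bool" where
  "H_closed ends H \<X> \<longleftrightarrow> (\<forall>X\<in>\<X>. covers ends X H \<longrightarrow> meet_edges ends X H \<in> \<X>)"

definition H_closed_for_addition :: "('e \<Rightarrow> 'v set) \<Rightarrow> 'e set \<Rightarrow> ('v, 'e) hypergraph set \<Rightarrow> bool" where
  "H_closed_for_addition ends H \<X> \<longleftrightarrow>
     (\<forall>X\<in>\<X>. covers ends X H \<and> H \<inter> E X = {} \<longrightarrow> meet_edges ends X H \<in> \<X>)"

definition pi_add :: "('e \<Rightarrow> 'v set) \<Rightarrow> 'e set \<Rightarrow> ('v, 'e) hypergraph \<Rightarrow> ('v, 'e) hypergraph" where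
  "pi_add ends H X = (if covers ends X H \<and> H \<inter> E X = {} then X \<boxplus> H else X)"

definition S_add ::
    "('e \<Rightarrow> 'v set) \<Rightarrow> 'e set \<Rightarrow> ('v, 'e) hypergraph set \<Rightarrow> ('v, 'e) hypergraph set" where
  "S_add ends H \<X> = {S \<in> \<X>. covers ends S H \<and> H \<inter> E S = {} \<and> S = meet_edges ends S H}"

definition D_add :: "('e \<Rightarrow> 'v set) \<Rightarrow> 'e set \<Rightarrow> ('v, 'e) hypergraph \<Rightarrow> ('v, 'e) hypergraph set" where
  "D_add ends H X = (if covers ends X H \<and> H \<inter> E X = {} then {meet_edges ends X H} else {})"

definition pi_toggle :: "('e \<Rightarrow> 'v set) \<Rightarrow> 'e set \<Rightarrow> ('v, 'e) hypergraph \<Rightarrow> ('v, 'e) hypergraph" where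
  "pi_toggle ends H X = (if covers ends X H then X \<boxplus> H else X)"

definition S_toggle ::
    "('e \<Rightarrow> 'v set) \<Rightarrow> 'e set \<Rightarrow> ('v, 'e) hypergraph set \<Rightarrow> ('v, 'e) hypergraph set" where
  "S_toggle ends H \<X> = {S \<in> \<X>. covers ends S H \<and> S = meet_edges ends S H}"

definition D_toggle :: "('e \<Rightarrow> 'v set) \<Rightarrow> 'e set \<Rightarrow> ('v, 'e) hypergraph \<Rightarrow> ('v, 'e) hypergraph set" where
  "D_toggle ends H X = (if covers ends X H then {meet_edges ends X H} else {})"

end

theory Submission
  imports Defs
begin

text \<open>
  A component of a hypergraph is a class of the equivalence relation generated by adjacency, together
  with every hyperedge that touches the class (\<open>components_eq\<close>). So a hyperedge that touches a
  component belongs to it (\<open>edge_in_component\<close>), and \<open>X \<and> H\<close> is a direct summand of \<open>X\<close> whose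
  components are exactly the components of \<open>X\<close> touched by \<open>H\<close> (\<open>components_meet_edges\<close>). When \<open>H\<close>
  is covered by the vertices of \<open>X\<close>, it is therefore covered by those of \<open>X \<and> H\<close>, and toggling
  \<open>H\<close> in \<open>X\<close> amounts to toggling it in \<open>X \<and> H\<close> and leaving the rest alone
  (\<open>toggle_direct_sum\<close>).

  Three consequences carry the proof.
  \<^item> Nonredundancy: if \<open>S = S \<and> H\<close>, each component of \<open>S\<close> is touched by some \<open>e \<in> H\<close>. A common
    component of \<open>S\<close> and \<open>S \<boxplus> H\<close> would have to contain \<open>e\<close>, which lies in only one of them
    (\<open>components_toggle_disjoint\<close>).
  \<^item> Locality: if \<open>S\<close> covers \<open>H\<close> and the components of \<open>S\<close> are components of \<open>X\<close>, then \<open>X\<close> covers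
    \<open>H\<close> and contains the same members of \<open>H\<close> as \<open>S\<close> (\<open>covers_components_mono\<close>).
  \<^item> Maximality: such an \<open>S\<close> with \<open>S = S \<and> H\<close> consists of components of \<open>X\<close> touched by \<open>H\<close>, so it
    is contained in \<open>X \<and> H\<close> (\<open>toggleable_maximal_subset\<close>).

  By locality, if \<open>X\<close> covers \<open>H\<close>, a condition on \<open>H \<inter> E X\<close> gives the same answer for \<open>X\<close> and for
  \<open>X \<and> H\<close>. Hence toggling \<open>H\<close> only where such a condition \<open>P\<close> holds is a hypergraph transformation,
  provided that the domain contains \<open>X \<and> H\<close> whenever \<open>H\<close> is toggled in \<open>X\<close>
  (\<open>toggle_transformation\<close>). Addition is the case where \<open>P\<close> says that the set is empty, and
  addition/deletion the case where \<open>P\<close> is always true. Locality also makes the support of addition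
  upward closed in that of addition/deletion.
\<close>

section \<open>Components as classes of the adjacency relation\<close>

definition adj :: "('e \<Rightarrow> 'v set) \<Rightarrow> ('v, 'e) hypergraph \<Rightarrow> ('v \<times> 'v) set" where
  "adj ends X = {(u, w). \<exists>e\<in>E X. u \<in> ends e \<and> w \<in> ends e}"

text \<open>Touching the class and lying inside it are the same thing for a nonempty hyperedge; asking
  only for touching makes \<open>edge_in_component\<close> immediate.\<close>

definition component_at ::
    "('e \<Rightarrow> 'v set) \<Rightarrow> ('v, 'e) hypergraph \<Rightarrow> 'v \<Rightarrow> ('v, 'e) hypergraph" where
  "component_at ends X v =
     ((adj ends X)\<^sup>* `` {v}, {e \<in> E X. ends e \<inter> (adj ends X)\<^sup>* `` {v} \<noteq> {}})"

text \<open>Nonempty hyperedges are what lets vertices control everything: without them \<open>({}, {e})\<close> would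
  be a connected hypergraph with no vertex to generate it.\<close>

definition well_formed :: "('e \<Rightarrow> 'v set) \<Rightarrow> ('v, 'e) hypergraph \<Rightarrow> bool" where
  "well_formed ends X \<longleftrightarrow> edges_within ends X \<and> (\<forall>e\<in>E X. ends e \<noteq> {})"

lemma adj_sym: "(u, w) \<in> adj ends X \<Longrightarrow> (w, u) \<in> adj ends X"
  by (auto simp: adj_def)

lemma adj_rtrancl_sym: "(u, w) \<in> (adj ends X)\<^sup>* \<Longrightarrow> (w, u) \<in> (adj ends X)\<^sup>*"
  by (meson adj_sym sym_def sym_rtrancl)

lemma adj_rtrancl_in_V:
  assumes "edges_within ends X" "(u, w) \<in> (adj ends X)\<^sup>*" "u \<in> V X"
  shows "w \<in> V X"
  using assms(2,3)
proof (induction rule: rtrancl_induct)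
  case (step y z)
  then show ?case using assms(1) by (auto simp: adj_def edges_within_def)
qed

lemma adj_mono: "E Y \<subseteq> E X \<Longrightarrow> adj ends Y \<subseteq> adj ends X"
  by (auto simp: adj_def)

lemma is_path_reaches:
  assumes "is_path ends X vs es"
  shows "(hd vs, last vs) \<in> (adj ends X)\<^sup>*"
proof -
  have len: "length vs = Suc (length es)" using assms by (simp add: is_path_def)
  have "(vs ! 0, vs ! i) \<in> (adj ends X)\<^sup>*" if "i \<le> length es" for i
    using that
  proof (induction i)
    case (Suc i)
    then have "(vs ! i, vs ! Suc i) \<in> adj ends X"
      using assms unfolding is_path_def adj_def by (auto intro!: bexI[of _ "es ! i"])
    with Suc show ?case by (meson Suc_leD rtrancl.rtrancl_into_rtrancl)
  qed simp
  from this[of "length es"] show ?thesis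
    using len by (metis diff_Suc_1 hd_conv_nth last_conv_nth length_0_conv nat.distinct(1) order_refl)
qed

text \<open>A path that already visits \<open>w\<close> is cut there. Otherwise, leaving the path at the first vertex
  incident with the new hyperedge keeps both the vertices
  and the hyperedges distinct: an earlier use of the same hyperedge would give an earlier incident
  vertex.\<close>

lemma is_path_extend:
  assumes p: "is_path ends X vs es" and e: "e \<in> E X" "last vs \<in> ends e" "w \<in> ends e" "w \<in> V X"
  shows "\<exists>vs' es'. is_path ends X vs' es' \<and> hd vs' = hd vs \<and> last vs' = w"
proof (cases "w \<in> set vs")
  case True
  obtain k where k: "k < length vs" "vs ! k = w" using True by (auto simp: in_set_conv_nth)
  have "is_path ends X (take (Suc k) vs) (take k es)"
    using p k unfolding is_path_def
    by (auto dest: in_set_takeD)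
  moreover have "hd (take (Suc k) vs) = hd vs" by simp
  moreover have "last (take (Suc k) vs) = w" using k by (simp add: take_Suc_conv_app_nth)
  ultimately show ?thesis by blast
next
  case False
  have len: "length vs = Suc (length es)" using p by (simp add: is_path_def)
  define k where "k = (LEAST k. k < length vs \<and> vs ! k \<in> ends e)"
  have "vs \<noteq> []" using len by auto
  then have ex: "length es < length vs \<and> vs ! length es \<in> ends e"
    using e(2) len by (simp add: last_conv_nth)
  have k: "k < length vs" "vs ! k \<in> ends e"
    using LeastI[of "\<lambda>k. k < length vs \<and> vs ! k \<in> ends e", OF ex] by (auto simp: k_def)
  have least: "vs ! j \<notin> ends e" if "j < k" for j
    using not_less_Least[of j "\<lambda>k. k < length vs \<and> vs ! k \<in> ends e"] that k(1)
    by (auto simp: k_def)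
  have kes: "k \<le> length es" using k(1) len by simp
  have new: "e \<notin> set (take k es)"
  proof
    assume "e \<in> set (take k es)"
    then obtain j where "j < k" "j < length es" "es ! j = e" by (auto simp: in_set_conv_nth)
    with p least show False unfolding is_path_def by metis
  qed
  have "is_path ends X (take (Suc k) vs @ [w]) (take k es @ [e])"
    unfolding is_path_def
  proof (intro conjI allI impI)
    show "length (take (Suc k) vs @ [w]) = Suc (length (take k es @ [e]))"
      using k(1) kes len by simp
    show "set (take (Suc k) vs @ [w]) \<subseteq> V X"
      using p e(4) by (auto simp: is_path_def dest!: in_set_takeD)
    show "set (take k es @ [e]) \<subseteq> E X"
      using p e(1) by (auto simp: is_path_def dest!: in_set_takeD)
    show "distinct (take (Suc k) vs @ [w])"
      using p False by (auto simp: is_path_def dest!: in_set_takeD)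
    show "distinct (take k es @ [e])"
      using p new by (auto simp: is_path_def)
  next
    fix i assume i: "i < length (take k es @ [e])"
    then have "i < k \<or> i = k" using kes by auto
    then show "(take (Suc k) vs @ [w]) ! i \<in> ends ((take k es @ [e]) ! i)"
      using p k kes len by (auto simp: is_path_def nth_append)
    from \<open>i < k \<or> i = k\<close>
    show "(take (Suc k) vs @ [w]) ! Suc i \<in> ends ((take k es @ [e]) ! i)"
      using p k kes len e(3) by (auto simp: is_path_def nth_append)
  qed
  moreover have "hd (take (Suc k) vs @ [w]) = hd vs" using len by (cases vs) auto
  ultimately show ?thesis by (metis last_snoc)
qed

lemma reaches_is_path:
  assumes "edges_within ends X" "(u, w) \<in> (adj ends X)\<^sup>*" "u \<in> V X"
  shows "\<exists>vs es. is_path ends X vs es \<and> hd vs = u \<and> last vs = w"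
  using assms(2)
proof (induction rule: rtrancl_induct)
  case base
  have "is_path ends X [u] []" using assms(3) by (simp add: is_path_def)
  then show ?case by (metis last.simps list.sel(1))
next
  case (step y z)
  from step.IH obtain vs es where p: "is_path ends X vs es" "hd vs = u" "last vs = y" by blast
  from step.hyps(2) obtain e where "e \<in> E X" "y \<in> ends e" "z \<in> ends e"
    by (auto simp: adj_def)
  with is_path_extend[OF p(1), of e z] p(2,3) assms(1) show ?case
    by (auto simp: edges_within_def)
qed

lemma connected_hg_iff:
  assumes "well_formed ends X"
  shows "connected_hg ends X \<longleftrightarrow> V X \<noteq> {} \<and> (\<forall>u\<in>V X. \<forall>w\<in>V X. (u, w) \<in> (adj ends X)\<^sup>*)"
proof -
  have "X \<noteq> null_hg \<longleftrightarrow> V X \<noteq> {}"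
    using assms by (cases X) (fastforce simp: null_hg_def well_formed_def edges_within_def)
  then show ?thesis
    using assms is_path_reaches reaches_is_path unfolding connected_hg_def well_formed_def by metis
qed

lemma well_formed_subhypergraph:
  "well_formed ends X \<Longrightarrow> subhypergraph ends Y X \<Longrightarrow> well_formed ends Y"
  by (auto simp: well_formed_def subhypergraph_def)

lemma subhypergraph_antisym:
  "subhypergraph ends Y X \<Longrightarrow> subhypergraph ends X Y \<Longrightarrow> X = Y"
  by (auto simp: subhypergraph_def prod_eq_iff)

lemma component_at_subhypergraph:
  assumes "edges_within ends X" "v \<in> V X"
  shows "subhypergraph ends (component_at ends X v) X"
  unfolding subhypergraph_def
proof (intro conjI)
  show "edges_within ends (component_at ends X v)"
    unfolding edges_within_def
  proof (intro ballI subsetI)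
    fix e w assume e: "e \<in> E (component_at ends X v)" "w \<in> ends e"
    then obtain x where x: "e \<in> E X" "x \<in> ends e" "(v, x) \<in> (adj ends X)\<^sup>*"
      by (auto simp: component_at_def)
    then have "(x, w) \<in> adj ends X" using e(2) by (auto simp: adj_def)
    with x(3) show "w \<in> V (component_at ends X v)" by (simp add: component_at_def)
  qed
qed (use adj_rtrancl_in_V[OF assms(1) _ assms(2)] in \<open>auto simp: component_at_def\<close>)

lemma component_at_connected:
  assumes "well_formed ends X" "v \<in> V X"
  shows "connected_hg ends (component_at ends X v)"
proof -
  let ?K = "component_at ends X v"
  have "well_formed ends ?K"
    using well_formed_subhypergraph[OF assms(1) component_at_subhypergraph[OF _ assms(2)]] assms(1)
    by (simp add: well_formed_def)
  moreover have from_v: "(v, w) \<in> (adj ends ?K)\<^sup>*" if "(v, w) \<in> (adj ends X)\<^sup>*" for w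
    using that
  proof (induction rule: rtrancl_induct)
    case (step y z)
    then have "(y, z) \<in> adj ends ?K" by (auto simp: adj_def component_at_def)
    with step.IH show ?case by simp
  qed simp
  moreover have "(u, w) \<in> (adj ends ?K)\<^sup>*" if "u \<in> V ?K" "w \<in> V ?K" for u w
  proof -
    have "(v, u) \<in> (adj ends ?K)\<^sup>*" "(v, w) \<in> (adj ends ?K)\<^sup>*"
      using that from_v by (auto simp: component_at_def)
    then show ?thesis by (meson adj_rtrancl_sym rtrancl_trans)
  qed
  moreover have "v \<in> V ?K" by (simp add: component_at_def)
  ultimately show ?thesis by (auto simp: connected_hg_iff)
qed

text \<open>The absorption property behind maximality: no connected subhypergraph reaches beyond the class
  of one of its vertices.\<close>

lemma connected_subhypergraph_component_at:
  assumes "well_formed ends X" "subhypergraph ends D X" "connected_hg ends D" "v \<in> V D"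
  shows "subhypergraph ends D (component_at ends X v)"
proof -
  have wfD: "well_formed ends D" using assms well_formed_subhypergraph by blast
  have mono: "(adj ends D)\<^sup>* \<subseteq> (adj ends X)\<^sup>*"
    using assms(2) by (intro rtrancl_mono adj_mono) (simp add: subhypergraph_def)
  have reach: "(v, w) \<in> (adj ends X)\<^sup>*" if "w \<in> V D" for w
    using that assms(3,4) mono wfD by (auto simp: connected_hg_iff)
  have "ends e \<inter> (adj ends X)\<^sup>* `` {v} \<noteq> {}" if "e \<in> E D" for e
    using that wfD reach by (fastforce simp: well_formed_def edges_within_def)
  with reach assms(2) show ?thesis
    by (auto simp: subhypergraph_def component_at_def)
qed

text \<open>Classes are connected and absorb every connected subhypergraph that shares a vertex with them,
  so they are exactly the maximal connected subhypergraphs.\<close>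

lemma components_eq:
  assumes wf: "well_formed ends X"
  shows "components ends X = component_at ends X ` V X"
proof (intro equalityI subsetI)
  fix C assume "C \<in> components ends X"
  then have C: "subhypergraph ends C X" "connected_hg ends C"
    and max: "\<And>D. subhypergraph ends D X \<Longrightarrow> connected_hg ends D \<Longrightarrow> subhypergraph ends C D \<Longrightarrow> D = C"
    by (auto simp: components_def)
  have "well_formed ends C" using wf C(1) well_formed_subhypergraph by blast
  with C(2) obtain v where v: "v \<in> V C" by (auto simp: connected_hg_iff)
  then have vX: "v \<in> V X" using C(1) by (auto simp: subhypergraph_def)
  have "edges_within ends X" using wf by (simp add: well_formed_def)
  then have "component_at ends X v = C"
    using max[OF component_at_subhypergraph[OF _ vX] component_at_connected[OF wf vX]
        connected_subhypergraph_component_at[OF wf C v]] by blast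
  with vX show "C \<in> component_at ends X ` V X" by blast
next
  fix C assume "C \<in> component_at ends X ` V X"
  then obtain v where v: "v \<in> V X" and C: "C = component_at ends X v" by blast
  have "v \<in> V C" by (simp add: C component_at_def)
  have "edges_within ends X" using wf by (simp add: well_formed_def)
  from component_at_subhypergraph[OF this v] have sub: "subhypergraph ends C X"
    by (simp only: C)
  have "D = C" if "subhypergraph ends D X" "connected_hg ends D" "subhypergraph ends C D" for D
  proof -
    have "v \<in> V D" using that(3) \<open>v \<in> V C\<close> by (auto simp: subhypergraph_def)
    with connected_subhypergraph_component_at[OF wf that(1,2)] that(3) show ?thesis
      unfolding C using subhypergraph_antisym by blast
  qed
  with sub show "C \<in> components ends X"
    using component_at_connected[OF wf v] by (auto simp: components_def C)
qed

lemma in_V_component_at [simp]: "v \<in> V (component_at ends X v)"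
  by (simp add: component_at_def)

lemma component_at_eq:
  assumes "w \<in> V (component_at ends X v)"
  shows "component_at ends X w = component_at ends X v"
proof -
  have "(v, w) \<in> (adj ends X)\<^sup>*" using assms by (simp add: component_at_def)
  then have "(adj ends X)\<^sup>* `` {w} = (adj ends X)\<^sup>* `` {v}"
    by (auto dest: adj_rtrancl_sym intro: rtrancl_trans)
  then show ?thesis by (simp add: component_at_def)
qed

lemma component_eq_component_at:
  assumes "well_formed ends X" "C \<in> components ends X" "v \<in> V C"
  shows "C = component_at ends X v"
proof -
  obtain u where u: "C = component_at ends X u" using assms(1,2) by (auto simp: components_eq)
  show ?thesis using component_at_eq assms(3) unfolding u by metis
qed

lemma component_subhypergraph: "C \<in> components ends X \<Longrightarrow> subhypergraph ends C X"
  by (simp add: components_def)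

lemma edge_in_component:
  assumes "well_formed ends X" "C \<in> components ends X" "e \<in> E X" "ends e \<inter> V C \<noteq> {}"
  shows "e \<in> E C"
proof -
  obtain v where "v \<in> ends e" "v \<in> V C" using assms(4) by blast
  then have "e \<in> E (component_at ends X v)" using assms(3) by (auto simp: component_at_def)
  then show ?thesis using component_eq_component_at[OF assms(1,2) \<open>v \<in> V C\<close>] by simp
qed

lemma hg_union_components:
  assumes "well_formed ends X"
  shows "hg_union (components ends X) (\<lambda>C. C) = X"
proof -
  have "E X \<subseteq> (\<Union>C\<in>components ends X. E C)"
  proof
    fix e assume e: "e \<in> E X"
    then obtain v where v: "v \<in> ends e" "v \<in> V X"
      using assms by (fastforce simp: well_formed_def edges_within_def)
    then have "e \<in> E (component_at ends X v)" using e by (auto simp: component_at_def)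
    with v show "e \<in> (\<Union>C\<in>components ends X. E C)" using assms by (auto simp: components_eq)
  qed
  moreover have "V X \<subseteq> (\<Union>C\<in>components ends X. V C)"
    using assms by (fastforce simp: components_eq)
  ultimately have "(\<Union>C\<in>components ends X. V C) = V X" "(\<Union>C\<in>components ends X. E C) = E X"
    using component_subhypergraph[of _ ends X] by (fastforce simp: subhypergraph_def)+
  then show ?thesis by (simp add: hg_union_def)
qed

section \<open>Direct summands\<close>

text \<open>The first argument is a direct summand of the second: no hyperedge outside it touches it, so
  the remaining vertices and hyperedges form a hypergraph of their own.\<close>

definition summand :: "('e \<Rightarrow> 'v set) \<Rightarrow> ('v, 'e) hypergraph \<Rightarrow> ('v, 'e) hypergraph \<Rightarrow> bool" where
  "summand ends M X \<longleftrightarrow> subhypergraph ends M X \<and> (\<forall>e\<in>E X. ends e \<inter> V M \<noteq> {} \<longrightarrow> e \<in> E M)"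

text \<open>A walk that starts in a summand cannot leave it, since every hyperedge it uses touches the
  summand and hence belongs to it.\<close>

lemma component_at_summand:
  assumes "summand ends M X" "v \<in> V M"
  shows "component_at ends M v = component_at ends X v"
proof -
  have sub: "E M \<subseteq> E X" and within: "edges_within ends M"
    using assms(1) by (auto simp: summand_def subhypergraph_def)
  have "(v, w) \<in> (adj ends M)\<^sup>*" if "(v, w) \<in> (adj ends X)\<^sup>*" for w
    using that
  proof (induction rule: rtrancl_induct)
    case (step y z)
    have "y \<in> V M" using adj_rtrancl_in_V[OF within step.IH assms(2)] .
    with step.hyps(2) assms(1) have "(y, z) \<in> adj ends M"
      by (auto simp: adj_def summand_def)
    with step.IH show ?case by simp
  qed simp
  then have cl: "(adj ends M)\<^sup>* `` {v} = (adj ends X)\<^sup>* `` {v}"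
    using rtrancl_mono[OF adj_mono[OF sub]] by blast
  have "(adj ends X)\<^sup>* `` {v} \<subseteq> V M"
    using adj_rtrancl_in_V[OF within _ assms(2)] cl by blast
  then have "e \<in> E M" if "e \<in> E X" "ends e \<inter> (adj ends X)\<^sup>* `` {v} \<noteq> {}" for e
    using that assms(1) unfolding summand_def by blast
  with sub have "{e \<in> E M. ends e \<inter> (adj ends X)\<^sup>* `` {v} \<noteq> {}} =
      {e \<in> E X. ends e \<inter> (adj ends X)\<^sup>* `` {v} \<noteq> {}}" by blast
  then show ?thesis by (simp only: component_at_def cl)
qed

lemma components_summand:
  assumes "well_formed ends X" "summand ends M X"
  shows "components ends M = {C \<in> components ends X. V C \<inter> V M \<noteq> {}}"
proof -
  have "subhypergraph ends M X" using assms(2) by (simp add: summand_def)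
  then have wfM: "well_formed ends M" and sub: "V M \<subseteq> V X"
    using well_formed_subhypergraph[OF assms(1)] by (auto simp: subhypergraph_def)
  have "components ends M = component_at ends X ` V M"
    using component_at_summand[OF assms(2)] by (simp add: components_eq wfM)
  also have "\<dots> = {C \<in> components ends X. V C \<inter> V M \<noteq> {}}"
  proof (intro equalityI subsetI)
    fix C assume "C \<in> component_at ends X ` V M"
    then obtain v where "v \<in> V M" "C = component_at ends X v" by blast
    moreover from this have "v \<in> V C \<inter> V M" by simp
    ultimately show "C \<in> {C \<in> components ends X. V C \<inter> V M \<noteq> {}}"
      using sub components_eq[OF assms(1)] by blast
  next
    fix C assume "C \<in> {C \<in> components ends X. V C \<inter> V M \<noteq> {}}"
    then obtain v where "C \<in> components ends X" "v \<in> V C" "v \<in> V M" by blast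
    with component_eq_component_at[OF assms(1)] show "C \<in> component_at ends X ` V M" by blast
  qed
  finally show ?thesis .
qed

text \<open>This discharges the definite description: a complement of \<open>M\<close> must avoid the vertices of
  \<open>M\<close>, and it cannot contain a hyperedge of \<open>M\<close> because that hyperedge is nonempty.\<close>

lemma direct_diff_summand:
  assumes "well_formed ends X" "summand ends M X"
  shows "direct_diff ends X M = (V X - V M, E X - E M)"
  unfolding direct_diff_def
proof (rule the_equality)
  show "edges_within ends (V X - V M, E X - E M) \<and> vertex_disjoint (V X - V M, E X - E M) M
      \<and> X = oplus (V X - V M, E X - E M) M"
    using assms unfolding summand_def subhypergraph_def well_formed_def edges_within_def
      vertex_disjoint_def oplus_def prod_eq_iff fst_conv snd_conv by blast
next
  fix Y assume Y: "edges_within ends Y \<and> vertex_disjoint Y M \<and> X = oplus Y M"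
  have "ends e \<noteq> {}" "ends e \<subseteq> V M" if "e \<in> E M" for e
    using that assms by (auto simp: summand_def subhypergraph_def well_formed_def edges_within_def)
  with Y have "E Y \<inter> E M = {}"
    unfolding edges_within_def vertex_disjoint_def by blast
  with Y show "Y = (V X - V M, E X - E M)"
    by (auto simp: vertex_disjoint_def oplus_def prod_eq_iff)
qed

section \<open>The part of a hypergraph met by a set of hyperedges\<close>

lemma V_meet_edges:
  "V (meet_edges ends X H) = (\<Union>C\<in>{C \<in> components ends X. \<exists>e\<in>H. ends e \<inter> V C \<noteq> {}}. V C)"
  by (simp add: meet_edges_def hg_union_def)

lemma meet_edges_summand:
  assumes "well_formed ends X"
  shows "summand ends (meet_edges ends X H) X"
proof -
  have sub: "subhypergraph ends C X" if "C \<in> components ends X" for C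
    using that by (rule component_subhypergraph)
  have "e \<in> E (meet_edges ends X H)"
    if "e \<in> E X" "ends e \<inter> V (meet_edges ends X H) \<noteq> {}" for e
    using that edge_in_component[OF assms] unfolding meet_edges_def hg_union_def by fastforce
  moreover have "subhypergraph ends (meet_edges ends X H) X"
    using sub unfolding subhypergraph_def edges_within_def meet_edges_def hg_union_def
    by fastforce
  ultimately show ?thesis by (simp add: summand_def)
qed

text \<open>A component of \<open>X\<close> sharing a vertex with \<open>X \<and> H\<close> coincides with one of the components from
  which \<open>X \<and> H\<close> was assembled.\<close>

lemma components_meet_edges:
  assumes "well_formed ends X"
  shows "components ends (meet_edges ends X H) =
    {C \<in> components ends X. \<exists>e\<in>H. ends e \<inter> V C \<noteq> {}}" (is "_ = ?R")
proof -
  show ?thesis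
    unfolding components_summand[OF assms meet_edges_summand[OF assms]]
  proof (intro equalityI subsetI)
    fix C assume "C \<in> {C \<in> components ends X. V C \<inter> V (meet_edges ends X H) \<noteq> {}}"
    then obtain v where C: "C \<in> components ends X" "v \<in> V C" and "v \<in> V (meet_edges ends X H)"
      by blast
    then obtain C' where C': "C' \<in> ?R" "v \<in> V C'" unfolding V_meet_edges by blast
    then have "C' = C"
      using component_eq_component_at[OF assms C] component_eq_component_at[OF assms, of C' v]
      by simp
    with C'(1) show "C \<in> ?R" by simp
  next
    fix C assume C: "C \<in> ?R"
    then have "V C \<noteq> {}" by blast
    moreover have "V C \<subseteq> V (meet_edges ends X H)" unfolding V_meet_edges using C by blast
    ultimately show "C \<in> {C \<in> components ends X. V C \<inter> V (meet_edges ends X H) \<noteq> {}}"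
      using C by blast
  qed
qed

lemma meet_edges_idem:
  assumes "well_formed ends X"
  shows "meet_edges ends (meet_edges ends X H) H = meet_edges ends X H"
proof -
  have "{C \<in> components ends (meet_edges ends X H). \<exists>e\<in>H. ends e \<inter> V C \<noteq> {}}
      = {C \<in> components ends X. \<exists>e\<in>H. ends e \<inter> V C \<noteq> {}}"
    using components_meet_edges[OF assms] by auto
  then show ?thesis by (simp add: meet_edges_def)
qed

lemma covers_meet_edges:
  assumes "well_formed ends X" "covers ends X H"
  shows "covers ends (meet_edges ends X H) H"
  unfolding covers_def
proof (intro UN_least subsetI)
  fix e v assume ev: "e \<in> H" "v \<in> ends e"
  then have "v \<in> V X" using assms(2) by (auto simp: covers_def)
  then have "component_at ends X v \<in> components ends X"
    using assms(1) by (simp add: components_eq)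
  moreover have "ends e \<inter> V (component_at ends X v) \<noteq> {}"
    using ev(2) in_V_component_at[of v ends X] by blast
  ultimately have "v \<in> (\<Union>C\<in>{C \<in> components ends X. \<exists>e\<in>H. ends e \<inter> V C \<noteq> {}}. V C)"
    using ev(1) in_V_component_at[of v ends X] by blast
  then show "v \<in> V (meet_edges ends X H)" by (simp only: V_meet_edges)
qed

text \<open>A hyperedge of \<open>H\<close> in \<open>X\<close> touches a component of \<open>S\<close>, because \<open>S\<close> covers it; that component
  is also one of \<open>X\<close> and therefore contains the hyperedge. So enlarging \<open>S\<close> by further components
  adds no member of \<open>H\<close>.\<close>

lemma covers_components_mono:
  assumes wf: "well_formed ends S" "well_formed ends X"
    and S: "covers ends S H" "components ends S \<subseteq> components ends X"
    and H: "\<forall>e\<in>H. ends e \<noteq> {}"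
  shows "covers ends X H" "H \<inter> E X = H \<inter> E S"
proof -
  have VE: "V S \<subseteq> V X" "E S \<subseteq> E X"
    using UN_mono[OF S(2) order_refl, of V] UN_mono[OF S(2) order_refl, of E]
      hg_union_components[OF wf(1)] hg_union_components[OF wf(2)]
    by (simp_all add: hg_union_def prod_eq_iff)
  then show "covers ends X H" using S(1) by (auto simp: covers_def)
  have "e \<in> E S" if e: "e \<in> H" "e \<in> E X" for e
  proof -
    obtain v where v: "v \<in> ends e" "v \<in> V S" using e(1) S(1) H by (fastforce simp: covers_def)
    then have C: "component_at ends S v \<in> components ends S" using wf(1) by (simp add: components_eq)
    have "ends e \<inter> V (component_at ends S v) \<noteq> {}"
      using v(1) in_V_component_at[of v ends S] by blast
    then have "e \<in> E (component_at ends S v)"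
      using edge_in_component[OF wf(2) subsetD[OF S(2) C] e(2)] by blast
    then show ?thesis using component_subhypergraph[OF C] by (auto simp: subhypergraph_def)
  qed
  with VE show "H \<inter> E X = H \<inter> E S" by blast
qed

lemma meet_edges_same_edges:
  assumes "well_formed ends X" "covers ends X H" "\<forall>e\<in>H. ends e \<noteq> {}"
  shows "H \<inter> E (meet_edges ends X H) = H \<inter> E X"
proof -
  have "well_formed ends (meet_edges ends X H)"
    using assms(1) meet_edges_summand well_formed_subhypergraph by (metis summand_def)
  from covers_components_mono(2)[OF this assms(1) covers_meet_edges[OF assms(1,2)] _ assms(3)]
  show ?thesis using components_meet_edges[OF assms(1)] by fastforce
qed

section \<open>Toggling a set of hyperedges\<close>

text \<open>A common component is touched by some \<open>e \<in> H\<close>. This \<open>e\<close> is a hyperedge of exactly one of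
  \<open>S\<close> and \<open>S \<boxplus> H\<close>; there it must lie in the component, which then cannot be a part of the
  other.\<close>

lemma components_toggle_disjoint:
  assumes wf: "well_formed ends S" and S: "covers ends S H" "S = meet_edges ends S H"
    and H: "\<forall>e\<in>H. ends e \<noteq> {}"
  shows "components ends S \<inter> components ends (S \<boxplus> H) = {}"
proof (rule ccontr)
  have wfT: "well_formed ends (S \<boxplus> H)"
    using wf S(1) H unfolding well_formed_def edges_within_def covers_def toggle_def by auto
  assume "\<not> ?thesis"
  then obtain C where C: "C \<in> components ends S" "C \<in> components ends (S \<boxplus> H)" by blast
  from C(1) have "C \<in> components ends (meet_edges ends S H)" using S(2) by simp
  then obtain e where e: "e \<in> H" "ends e \<inter> V C \<noteq> {}"
    by (auto simp: components_meet_edges[OF wf])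
  have sub: "E C \<subseteq> E S" "E C \<subseteq> E (S \<boxplus> H)"
    using C[THEN component_subhypergraph] by (auto simp: subhypergraph_def)
  show False
  proof (cases "e \<in> E S")
    case True
    then have "e \<in> E C" using edge_in_component[OF wf C(1)] e(2) by blast
    with sub(2) True e(1) show False by (auto simp: toggle_def)
  next
    case False
    then have "e \<in> E C" using edge_in_component[OF wfT C(2)] e by (auto simp: toggle_def)
    with sub(1) False show False by blast
  qed
qed

text \<open>The complement of \<open>X \<and> H\<close> contains no member of \<open>H\<close>, so the symmetric difference only affects
  \<open>X \<and> H\<close>.\<close>

lemma toggle_direct_sum:
  assumes wf: "well_formed ends X" and X: "covers ends X H" and H: "\<forall>e\<in>H. ends e \<noteq> {}"
  defines "M \<equiv> meet_edges ends X H"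
  shows "X \<boxplus> H = oplus (direct_diff ends X M) (M \<boxplus> H)"
proof -
  have M: "summand ends M X" "H \<inter> E M = H \<inter> E X"
    unfolding M_def using meet_edges_summand[OF wf] meet_edges_same_edges[OF wf X H] by blast+
  then have "V M \<subseteq> V X" "E M \<subseteq> E X" by (auto simp: summand_def subhypergraph_def)
  with M(2) show ?thesis
    unfolding direct_diff_summand[OF wf M(1)] by (auto simp: toggle_def oplus_def)
qed

text \<open>Finitely many vertices have finitely many subsets, each underlying finitely many labelled
  hyperedges. Without this, toggling could produce an infinite hyperedge set.\<close>

lemma (in hypergraph_family) covered_edges_finite:
  assumes "H \<subseteq> EE" "covers ends X H" "finite (V X)"
  shows "finite H"
proof -
  have "H \<subseteq> (\<Union>A\<in>ends ` H. {e \<in> EE. ends e = A})" using assms(1) by blast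
  moreover have "ends ` H \<subseteq> Pow (V X)" using assms(2) by (auto simp: covers_def)
  then have "finite (ends ` H)" using assms(3) by (meson finite_Pow_iff finite_subset)
  moreover have "finite {e \<in> EE. ends e = A}" if "A \<in> ends ` H" for A
    using that assms(1) ends_wf by (intro ends_finite) auto
  ultimately show ?thesis by (meson finite_UN_I finite_subset)
qed

lemma (in hypergraph_family) hypergraphs_well_formed:
  "X \<in> hypergraphs LV EE ends \<Longrightarrow> well_formed ends X"
  using ends_wf by (auto simp: hypergraphs_def well_formed_def)

lemma (in hypergraph_family) toggle_in_hypergraphs:
  assumes "H \<subseteq> EE" "covers ends X H" "X \<in> hypergraphs LV EE ends"
  shows "X \<boxplus> H \<in> hypergraphs LV EE ends"
proof -
  have "finite H" using covered_edges_finite assms by (auto simp: hypergraphs_def)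
  with assms show ?thesis
    by (auto simp: hypergraphs_def toggle_def edges_within_def covers_def)
qed

text \<open>The condition \<open>P\<close> sees \<open>X\<close> only through \<open>H \<inter> E X\<close>, which does not change when \<open>X\<close> is replaced
  by \<open>X \<and> H\<close> (if \<open>X\<close> covers \<open>H\<close>). Addition and addition/deletion are two choices of \<open>P\<close>.\<close>

definition toggleable ::
    "('e \<Rightarrow> 'v set) \<Rightarrow> 'e set \<Rightarrow> ('e set \<Rightarrow> bool) \<Rightarrow> ('v, 'e) hypergraph \<Rightarrow> bool" where
  "toggleable ends H P X \<longleftrightarrow> covers ends X H \<and> P (H \<inter> E X)"

lemma toggleable_meet_edges:
  assumes "well_formed ends X" "\<forall>e\<in>H. ends e \<noteq> {}" "toggleable ends H P X"
  shows "toggleable ends H P (meet_edges ends X H)"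
  using assms covers_meet_edges[of ends X H] meet_edges_same_edges[of ends X H]
  by (simp add: toggleable_def)

text \<open>If some \<open>S\<close> in the support has its components among those of \<open>X\<close>, locality makes \<open>X\<close>
  toggleable as well, so the candidate set is not empty; and as every component of \<open>S\<close> is touched by
  \<open>H\<close>, all of them are components of \<open>X \<and> H\<close>.\<close>

lemma toggleable_maximal_subset:
  fixes H and \<X> :: "('v, 'e) hypergraph set"
  assumes wf: "\<And>X. X \<in> \<X> \<Longrightarrow> well_formed ends X"
    and H: "\<forall>e\<in>H. ends e \<noteq> {}" "H \<noteq> {}"
    and closed: "\<And>X. X \<in> \<X> \<Longrightarrow> toggleable ends H P X \<Longrightarrow> meet_edges ends X H \<in> \<X>"
    and X: "X \<in> \<X>"
  shows "maximal_subset ends {S \<in> \<X>. toggleable ends H P S \<and> S = meet_edges ends S H} X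
     (if toggleable ends H P X then {meet_edges ends X H} else {})"
    (is "maximal_subset ends ?S X ?D")
proof -
  have "?D \<subseteq> ?S"
    using closed[OF X] toggleable_meet_edges[OF wf[OF X] H(1)] meet_edges_idem[OF wf[OF X]]
    by auto
  moreover have "pairwise (component_disjoint ends) ?D" by (simp add: pairwise_def)
  moreover have "null_hg \<notin> ?S"
    using H by (auto simp: toggleable_def covers_def null_hg_def)
  moreover have "\<forall>T\<in>?D. components ends T \<subseteq> components ends X"
    using components_meet_edges[OF wf[OF X]] by auto
  moreover have "\<exists>T\<in>?D. components ends S \<subseteq> components ends T"
    if S: "S \<in> ?S" and le: "components ends S \<subseteq> components ends X" for S
  proof -
    from S have wfS: "well_formed ends S" and tS: "toggleable ends H P S"
      and eq: "S = meet_edges ends S H" using wf by auto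
    have "toggleable ends H P X"
      using tS covers_components_mono[OF wfS wf[OF X] _ le H(1)] by (simp add: toggleable_def)
    moreover have "components ends S \<subseteq> components ends (meet_edges ends X H)"
      using components_meet_edges[OF wfS, of H] components_meet_edges[OF wf[OF X], of H] le eq
      by auto
    ultimately show ?thesis by simp
  qed
  ultimately show ?thesis unfolding maximal_subset_def by blast
qed

text \<open>Toggling keeps the vertex set, so the image of \<open>X \<and> H\<close> never collides with its complement in
  \<open>X\<close>: the applicable set is all of the maximal subset, and the direct-sum formula reduces to
  \<open>toggle_direct_sum\<close>, or to a trivial identity when the maximal subset is empty.\<close>

lemma (in hypergraph_family) toggle_transformation:
  assumes HE: "H \<subseteq> EE" and H0: "H \<noteq> {}" and \<X>: "\<X> \<subseteq> hypergraphs LV EE ends"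
    and closed: "\<And>X. X \<in> \<X> \<Longrightarrow> toggleable ends H P X \<Longrightarrow> meet_edges ends X H \<in> \<X>"
  defines "\<pi> \<equiv> \<lambda>X. if toggleable ends H P X then X \<boxplus> H else X"
    and "\<S> \<equiv> {S \<in> \<X>. toggleable ends H P S \<and> S = meet_edges ends S H}"
    and "\<D> \<equiv> \<lambda>X. if toggleable ends H P X then {meet_edges ends X H} else {}"
  shows "hypergraph_transformation_with LV EE ends \<X> \<pi> \<S> \<D>"
proof -
  have H: "\<forall>e\<in>H. ends e \<noteq> {}" using HE ends_wf by blast
  have wf: "well_formed ends X" if "X \<in> \<X>" for X
    using that \<X> hypergraphs_well_formed by blast
  have "\<pi> \<in> \<X> \<rightarrow> hypergraphs LV EE ends"
    using \<X> toggle_in_hypergraphs[OF HE] by (auto simp: \<pi>_def toggleable_def)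
  moreover have "\<forall>S\<in>\<S>. components ends S \<inter> components ends (\<pi> S) = {}"
    using components_toggle_disjoint[OF wf _ _ H] by (simp add: \<S>_def \<pi>_def toggleable_def)
  moreover have "null_hg \<notin> \<S>"
    using H H0 by (auto simp: \<S>_def toggleable_def covers_def null_hg_def)
  moreover have "component_maximal_with ends \<S> \<X> \<D>"
    unfolding component_maximal_with_def \<S>_def \<D>_def
    using toggleable_maximal_subset[OF wf H H0 closed] by auto
  moreover have "pairwise vertex_disjoint (\<pi> ` SX) \<and> card (\<pi> ` SX) = card SX
      \<and> \<pi> X = oplus (direct_diff ends X (direct_sum SX (\<lambda>S. S))) (direct_sum SX \<pi>)"
    if X: "X \<in> \<X>" and SX: "SX = applicable ends \<pi> (\<D> X) X" for X SX
  proof (cases "toggleable ends H P X")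
    case True
    define M where "M = meet_edges ends X H"
    have M: "summand ends M X" using meet_edges_summand[OF wf[OF X]] by (simp add: M_def)
    have \<pi>M: "\<pi> M = M \<boxplus> H"
      using toggleable_meet_edges[OF wf[OF X] H True] by (simp add: \<pi>_def M_def)
    have "SX = {M}"
      using True \<pi>M direct_diff_summand[OF wf[OF X] M]
      by (auto simp: SX applicable_def \<D>_def M_def[symmetric] toggle_def)
    moreover have "\<pi> X = oplus (direct_diff ends X M) (\<pi> M)"
      using toggle_direct_sum[OF wf[OF X] _ H] True \<pi>M
      by (simp add: \<pi>_def M_def toggleable_def)
    ultimately show ?thesis by (simp add: hg_union_def)
  next
    case False
    then have "SX = {}" by (simp add: SX applicable_def \<D>_def)
    \<comment> \<open>The null hypergraph is the empty direct sum, and subtracting it changes nothing.\<close>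
    moreover have "summand ends ({}, {}) X"
      by (simp add: summand_def subhypergraph_def edges_within_def)
    ultimately show ?thesis
      using False direct_diff_summand[OF wf[OF X]] by (simp add: hg_union_def oplus_def \<pi>_def)
  qed
  ultimately show ?thesis
    unfolding hypergraph_transformation_with_def Let_def using \<X> by (auto simp: \<S>_def)
qed

section \<open>Addition and its relation to addition/deletion\<close>

theorem proposition3p25:
  fixes LV :: "'v set" and EE :: "'e set" and ends :: "'e \<Rightarrow> 'v set" and loops :: bool
    and H :: "'e set" and \<X> :: "('v, 'e) hypergraph set"
  assumes "hypergraph_family LV EE ends loops"
    and "H \<subseteq> EE" and "H \<noteq> {}"
    and "\<X> \<subseteq> hypergraphs LV EE ends"
    and "H_closed_for_addition ends H \<X>"
  shows "hypergraph_transformation_with LV EE ends \<X> (pi_add ends H) (S_add ends H \<X>) (D_add ends H)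
    \<and> (H_closed ends H \<X> \<longrightarrow>
         support_reduction LV EE ends \<X>
           (pi_add ends H) (S_add ends H \<X>) (pi_toggle ends H) (S_toggle ends H \<X>)
         \<and> S_add ends H \<X> = {S \<in> S_toggle ends H \<X>. H \<inter> E S = {}}
         \<and> (\<forall>X\<in>\<X>. D_add ends H X = D_toggle ends H X \<inter> S_add ends H \<X>))"
proof -
  interpret hypergraph_family LV EE ends loops by fact
  have H: "\<forall>e\<in>H. ends e \<noteq> {}" using assms(2) ends_wf by blast
  have wf: "well_formed ends X" if "X \<in> \<X>" for X
    using that assms(4) hypergraphs_well_formed by blast
  have add: "hypergraph_transformation_with LV EE ends \<X>
      (pi_add ends H) (S_add ends H \<X>) (D_add ends H)"
    using toggle_transformation[OF assms(2,3,4), of "\<lambda>A. A = {}"] assms(5)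
    by (simp add: toggleable_def pi_add_def[abs_def] S_add_def D_add_def[abs_def]
        H_closed_for_addition_def)
  moreover have S_eq: "S_add ends H \<X> = {S \<in> S_toggle ends H \<X>. H \<inter> E S = {}}"
    by (auto simp: S_add_def S_toggle_def)
  moreover have "support_reduction LV EE ends \<X>
      (pi_add ends H) (S_add ends H \<X>) (pi_toggle ends H) (S_toggle ends H \<X>)"
    if closed: "H_closed ends H \<X>"
  proof -
    have "hypergraph_transformation_with LV EE ends \<X>
        (pi_toggle ends H) (S_toggle ends H \<X>) (D_toggle ends H)"
      using toggle_transformation[OF assms(2,3,4), of "\<lambda>_. True"] closed
      by (simp add: toggleable_def pi_toggle_def[abs_def] S_toggle_def D_toggle_def[abs_def]
          H_closed_def)
    \<comment> \<open>Upward closure: by locality a larger \<open>T\<close> still contains no member of \<open>H\<close>.\<close>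
    moreover have "T \<in> S_add ends H \<X>"
      if "S \<in> S_add ends H \<X>" "T \<in> S_toggle ends H \<X>" "components ends S \<subseteq> components ends T"
      for S T
    proof -
      have "S \<in> \<X>" "T \<in> \<X>" "covers ends S H" "H \<inter> E S = {}"
        using that by (auto simp: S_add_def S_toggle_def)
      with covers_components_mono(2)[OF wf wf _ that(3) H] that(2) show ?thesis
        unfolding S_eq by auto
    qed
    moreover have "S_add ends H \<X> \<subseteq> S_toggle ends H \<X>" unfolding S_eq by blast
    moreover have "\<forall>S\<in>S_add ends H \<X>. pi_add ends H S = pi_toggle ends H S"
      by (simp add: S_add_def pi_add_def pi_toggle_def)
    ultimately show ?thesis
      using add
      unfolding support_reduction_def hypergraph_transformation_def upward_closed_def by blast
  qed
  moreover have "D_add ends H X = D_toggle ends H X \<inter> S_add ends H \<X>" if X: "X \<in> \<X>" for X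
  proof -
    have "D_add ends H X \<subseteq> S_add ends H \<X>"
      using add X
      by (auto simp: hypergraph_transformation_with_def component_maximal_with_def
          maximal_subset_def)
    \<comment> \<open>Conversely, \<open>X \<and> H\<close> lies in the smaller support only if \<open>X\<close> itself contains no member of
      \<open>H\<close>, as both contain the same ones.\<close>
    moreover have "H \<inter> E X = {}" if "covers ends X H" "meet_edges ends X H \<in> S_add ends H \<X>"
      using that meet_edges_same_edges[OF wf[OF X] that(1) H] by (auto simp: S_add_def)
    ultimately show ?thesis
      by (cases "covers ends X H"; cases "H \<inter> E X = {}") (simp_all add: D_add_def D_toggle_def, blast)
  qed
  ultimately show ?thesis by blast
qed

end
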